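(* Let $d\ge 1$ be an integer. For $g>0$ and $\rho\in\mathbb{R}$ let $\alpha(g,\rho)=\tfrac12 g^{-1/2}(\rho-1)$, and let $\rho=\rho(g)$ be a real-valued function of $g>0$ chosen in such a way that $a=\lim_{g\to\infty}\alpha(g,\rho(g))$ exists in $[-\infty,\infty]$. Let $n\ge 1$ and $Y\in\mathcal{W}_n$. Then $$\lim_{g\to\infty}Q_{g,\rho(g),n}(Y)=\begin{cases}\dfrac{1}{Z_a}\displaystyle\prod_{x\in Y}e^{a^2}I_{n_x(Y)}(a) & \text{if } a\in(-\infty,\infty),\\[2mm] \dfrac{1}{c_n}\mathbf{1}_{Y\in\mathcal{S}_n} & \text{if } a=\infty,\\[2mm] \dfrac{1}{(2d)^n} & \text{if } a=-\infty,\end{cases}$$ where $Z_a$ is a normalisation constant (making the right-hand side a probability measure on $\mathcal{W}_n$), and the product over $x\in Y$ is over the distinct vertices visited by $Y$.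
   Context: $\mathcal{W}_n$ is the set of $n$-step nearest-neighbour walks in $\mathbb{Z}^d$ started from the origin, i.e. sequences $Y=(Y_0,\dots,Y_n)$ with $Y_i\in\mathbb{Z}^d$, $Y_0=0$, $|Y_{i+1}-Y_i|=1$ (Euclidean distance). $\mathcal{S}_n\subset\mathcal{W}_n$ is the set of self-avoiding walks ($Y_i\neq Y_j$ for all $i\ne j$), and $c_n=|\mathcal{S}_n|$. For $Y\in\mathcal{W}_n$ and $x\in\mathbb{Z}^d$, $n_x(Y)=\sum_{i=0}^n\mathbf{1}_{Y_i=x}$ is the number of visits to $x$. $X$ is the continuous-time Markov process on $\mathbb{Z}^d$ started at $0$ which takes uniformly random nearest-neighbour steps after independent $\mathrm{Exp}(1)$ holding times; $\mathbb{E}$ denotes its expectation, and $\mathbb{E}(\cdot\mid Y)$ denotes conditioning on the sequence of sites visited during the first $n$ steps of $X$ being $Y\in\mathcal{W}_n$. $T_n$ is the time of the $(n+1)$st jump of $X$ and $L_{x,n}=\int_0^{T_n}\mathbf{1}_{X(s)=x}\,ds$ is the local time at $x$ up to time $T_n$. For $g>0$ and $\rho\in\mathbb{R}$, the probability measure $Q_{g,\rho,n}$ on $\mathcal{W}_n$ is $$Q_{g,\rho,n}(Y)=\frac{1}{Z_n(g,\rho)}\,\mathbb{E}\Big(e^{-g\sum_x L_{x,n}^2+\rho\sum_x L_{x,n}}\,\Big|\,Y\Big),\qquad Z_n(g,\rho)=\sum_{Y\in\mathcal{W}_n}\mathbb{E}\Big(e^{-g\sum_x L_{x,n}^2+\rho\sum_x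 L_{x,n}}\,\Big|\,Y\Big),$$ where sums over $x$ are over $x\in\mathbb{Z}^d$. For $a\in\mathbb{R}$ and an integer $m\ge1$, $I_m(a)=\int_{-a}^\infty\frac{(a+u)^{m-1}}{(m-1)!}e^{-u^2}\,du$. *)

theory Defs
  imports "HOL-Probability.Probability"
begin

text \<open>Elements of \<open>int ^ 'd\<close> are the points of the lattice of dimension \<open>CARD('d)\<close>;
  Euclidean distances are taken after embedding into \<open>real ^ 'd\<close>.\<close>

definition lat :: "int ^ 'd \<Rightarrow> real ^ 'd" where
  "lat x = (\<chi> i. real_of_int (x $ i))"

definition walks :: "nat \<Rightarrow> (int ^ 'd) list set" where
  "walks n = {Y. length Y = Suc n \<and> Y ! 0 = 0 \<and> (\<forall>i<n. dist (lat (Y ! i)) (lat (Y ! Suc i)) = 1)}"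

definition saws :: "nat \<Rightarrow> (int ^ 'd) list set" where
  "saws n = {Y \<in> walks n. \<forall>i\<le>n. \<forall>j\<le>n. i \<noteq> j \<longrightarrow> Y ! i \<noteq> Y ! j}"

definition visits :: "(int ^ 'd) list \<Rightarrow> int ^ 'd \<Rightarrow> nat" where
  "visits Y x = (\<Sum>i<length Y. of_bool (Y ! i = x))"

definition unit_steps :: "(int ^ 'd) set" where
  "unit_steps = {e. dist (lat 0) (lat e) = 1}"

lemma norm_lat_eq_1_iff:
  fixes e :: "int ^ 'd"
  shows "norm (lat e) = 1 \<longleftrightarrow> (\<exists>i. e = axis i 1 \<or> e = axis i (- 1))"
proof
  assume "norm (lat e) = 1"
  hence "(\<Sum>i\<in>UNIV. (real_of_int (e $ i))\<^sup>2) = 1"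
    by (simp add: norm_vec_def L2_set_def lat_def)
  hence "real_of_int (\<Sum>i\<in>UNIV. (e $ i)\<^sup>2) = real_of_int 1" by simp
  hence s: "(\<Sum>i\<in>UNIV. (e $ i)\<^sup>2) = 1" by (simp only: of_int_eq_iff)
  then obtain i where i: "e $ i \<noteq> 0"
    by (metis (mono_tags, lifting) power_zero_numeral sum.neutral zero_neq_one)
  have split: "(\<Sum>i\<in>UNIV. (e $ i)\<^sup>2) = (e $ i)\<^sup>2 + (\<Sum>j\<in>UNIV - {i}. (e $ j)\<^sup>2)"
    by (simp add: sum.remove)
  have ge: "(e $ i)\<^sup>2 \<ge> 1" using i by (simp add: int_one_le_iff_zero_less)
  have nn: "(\<Sum>j\<in>UNIV - {i}. (e $ j)\<^sup>2) \<ge> 0" by (simp add: sum_nonneg)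
  have "(\<Sum>j\<in>UNIV - {i}. (e $ j)\<^sup>2) = 0" and i1: "(e $ i)\<^sup>2 = 1"
    using s split ge nn by linarith+
  hence z: "e $ j = 0" if "j \<noteq> i" for j
    using that by (simp add: sum_nonneg_eq_0_iff)
  have "e $ i = 1 \<or> e $ i = - 1" using i1 by (simp add: power2_eq_1_iff)
  with z show "\<exists>i. e = axis i 1 \<or> e = axis i (- 1)"
    by (auto simp: vec_eq_iff axis_def)
next
  have "lat (axis i c) = axis i (real_of_int c)" for i :: 'd and c
    by (auto simp: lat_def axis_def vec_eq_iff)
  moreover assume "\<exists>i. e = axis i 1 \<or> e = axis i (- 1)"
  ultimately show "norm (lat e) = 1"
    by (auto simp: norm_eq_1 inner_axis_axis)
qed

lemma unit_steps_eq:
  "unit_steps = range (\<lambda>i::'d::finite. axis i (1::int)) \<union> range (\<lambda>i. axis i (- 1))"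
proof -
  have "dist (lat 0) (lat e) = norm (lat e)" for e :: "int ^ 'd"
    by (simp add: lat_def dist_norm norm_vec_def)
  thus ?thesis by (auto simp: unit_steps_def norm_lat_eq_1_iff)
qed

lemma finite_unit_steps [simp]: "finite unit_steps"
  and unit_steps_nonempty [simp]: "unit_steps \<noteq> {}"
  by (auto simp: unit_steps_eq)

text \<open>A sample point is a pair of a sequence of holding times and a sequence of steps; under
  \<open>ctrw_space\<close> all of these are independent, the holding times are exponential with rate 1 and
  the steps are uniform nearest-neighbour steps.\<close>

type_synonym 'd sample = "(nat \<Rightarrow> real) \<times> (nat \<Rightarrow> int ^ 'd)"

definition ctrw_space :: "'d::finite sample measure" where
  "ctrw_space =
     (\<Pi>\<^sub>M i\<in>(UNIV::nat set). density lborel (\<lambda>t. ennreal (exponential_density 1 t)))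
     \<Otimes>\<^sub>M (\<Pi>\<^sub>M i\<in>(UNIV::nat set). measure_pmf (pmf_of_set unit_steps))"

lemma prob_space_ctrw_space: "prob_space (ctrw_space :: 'd::finite sample measure)"
proof -
  let ?E = "density lborel (\<lambda>t. ennreal (exponential_density 1 t))"
  let ?S = "measure_pmf (pmf_of_set (unit_steps :: (int ^ 'd) set))"
  have "prob_space (\<Pi>\<^sub>M i\<in>(UNIV::nat set). ?E)"
    by (rule prob_space_PiM) (simp add: prob_space_exponential_density)
  moreover have "prob_space (\<Pi>\<^sub>M i\<in>(UNIV::nat set). ?S)"
    by (rule prob_space_PiM) (rule prob_space_measure_pmf)
  ultimately show ?thesis
    unfolding ctrw_space_def by (rule prob_space_pair)
qed

text \<open>\<open>jump_time n\<close> is the time of the \<open>(n + 1)\<close>st jump, since the holding times are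
  indexed from 0; \<open>jump_chain k\<close> is the site occupied after \<open>k\<close> jumps.\<close>

definition jump_time :: "nat \<Rightarrow> 'd::finite sample \<Rightarrow> real" where
  "jump_time n \<omega> = (\<Sum>i\<le>n. fst \<omega> i)"

definition jump_chain :: "nat \<Rightarrow> 'd::finite sample \<Rightarrow> int ^ 'd" where
  "jump_chain k \<omega> = (\<Sum>i<k. snd \<omega> i)"

text \<open>At time \<open>t\<close> the number of jumps already made is the least \<open>k\<close> for which the
  \<open>(k + 1)\<close>st jump is still to come.  Such a \<open>k\<close> exists for all \<open>t\<close> almost surely.\<close>

definition ctrw :: "real \<Rightarrow> 'd::finite sample \<Rightarrow> int ^ 'd" where
  "ctrw t \<omega> = jump_chain (LEAST k. t < jump_time k \<omega>) \<omega>"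

definition local_time :: "int ^ 'd::finite \<Rightarrow> nat \<Rightarrow> 'd sample \<Rightarrow> real" where
  "local_time x n \<omega> = (LINT s:{0..jump_time n \<omega>}|lborel. of_bool (ctrw s \<omega> = x))"

definition cond_expect_walk :: "nat \<Rightarrow> (int ^ 'd::finite) list \<Rightarrow> ('d sample \<Rightarrow> real) \<Rightarrow> real" where
  "cond_expect_walk n Y f =
     (LINT \<omega>|uniform_measure ctrw_space {\<omega> \<in> space ctrw_space. \<forall>i\<le>n. jump_chain i \<omega> = Y ! i}. f \<omega>)"

definition weight :: "real \<Rightarrow> real \<Rightarrow> nat \<Rightarrow> (int ^ 'd::finite) list \<Rightarrow> real" where
  "weight g \<rho> n Y = cond_expect_walk n Y
     (\<lambda>\<omega>. exp (- g * (\<Sum>\<^sub>\<infinity>x\<in>UNIV. (local_time x n \<omega>)\<^sup>2) + \<rho> * (\<Sum>\<^sub>\<infinity>x\<in>UNIV. local_time x n \<omega>)))"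

definition partition_function :: "'d::finite itself \<Rightarrow> real \<Rightarrow> real \<Rightarrow> nat \<Rightarrow> real" where
  "partition_function _ g \<rho> n = (\<Sum>Y\<in>(walks n :: (int ^ 'd) list set). weight g \<rho> n Y)"

definition Q_walk :: "real \<Rightarrow> real \<Rightarrow> nat \<Rightarrow> (int ^ 'd::finite) list \<Rightarrow> real" where
  "Q_walk g \<rho> n Y = 1 / partition_function TYPE('d) g \<rho> n * weight g \<rho> n Y"

definition alpha :: "real \<Rightarrow> real \<Rightarrow> real" where
  "alpha g \<rho> = 1 / 2 * g powr (- 1 / 2) * (\<rho> - 1)"

definition I_fun :: "nat \<Rightarrow> real \<Rightarrow> real" where
  "I_fun m a = (LINT u:{- a..}|lborel. (a + u) ^ (m - 1) / fact (m - 1) * exp (- u\<^sup>2))"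

definition limit_weight :: "real \<Rightarrow> (int ^ 'd::finite) list \<Rightarrow> real" where
  "limit_weight a Y = (\<Prod>x\<in>set Y. exp (a\<^sup>2) * I_fun (visits Y x) a)"

definition limit_norm :: "'d::finite itself \<Rightarrow> nat \<Rightarrow> real \<Rightarrow> real" where
  "limit_norm _ n a = (\<Sum>Y\<in>(walks n :: (int ^ 'd) list set). limit_weight a Y)"

end

theory Submission
  imports Defs
begin

text \<open>Conditionally on the walk, the holding times are still independent exponentials, so the local
  times of the distinct sites are independent Gamma variables with parameters the visit counts.  Hence
  \<open>weight g \<rho> n Y\<close> factorises over the visited sites, and rescaling each local time by
  \<open>sqrt g\<close> and completing the square turns the factor of a site with \<open>m\<close> visits into
  \<open>g powr (- m / 2) * (exp (\<alpha>\<^sup>2) * I_fun m \<alpha>)\<close>.  The visit counts add up to \<open>n + 1\<close>, so the powers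
  of \<open>g\<close> cancel and \<open>Q_walk\<close> is exactly \<open>limit_weight\<close> normalised, at parameter \<open>\<alpha>\<close>.  It remains to
  let \<open>\<alpha>\<close> tend to \<open>a\<close> by dominated convergence.  With \<open>J\<^sub>m = exp (\<alpha>\<^sup>2) * I_fun m \<alpha>\<close>,
  as \<open>\<alpha> \<rightarrow> \<infinity>\<close> the quantity \<open>exp (- m * \<alpha>\<^sup>2) * J\<^sub>m\<close> tends to \<open>sqrt pi\<close> for \<open>m = 1\<close> and to \<open>0\<close> for
  \<open>m \<ge> 2\<close>, which leaves the self-avoiding walks; as \<open>\<alpha> \<rightarrow> -\<infinity>\<close> the quantity \<open>(- 2 * \<alpha>) ^ m * J\<^sub>m\<close>
  tends to \<open>1\<close> for every \<open>m\<close>, which gives the uniform measure.\<close>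

subsection \<open>Walks and visit counts\<close>

lemma dist_lat_eq_1_iff:
  fixes x y :: "int ^ 'd"
  shows "dist (lat x) (lat y) = 1 \<longleftrightarrow> y - x \<in> unit_steps"
proof -
  have "lat (y - x) = lat y - lat x" and "lat (0 :: int ^ 'd) = 0"
    by (auto simp: lat_def vec_eq_iff)
  then show ?thesis
    by (simp add: unit_steps_def dist_norm norm_minus_commute)
qed

lemma card_unit_steps: "card (unit_steps :: (int ^ 'd::finite) set) = 2 * CARD('d)"
proof -
  have "inj (\<lambda>i::'d. axis i (1::int))" "inj (\<lambda>i::'d. axis i (- 1 :: int))"
    by (auto simp: inj_def axis_eq_axis)
  moreover have "range (\<lambda>i::'d. axis i (1::int)) \<inter> range (\<lambda>i. axis i (- 1)) = {}"
    by (auto simp: axis_eq_axis)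
  ultimately show ?thesis
    by (simp add: unit_steps_eq card_Un_disjoint card_image)
qed

lemma walks_0: "walks 0 = {[0]}"
  by (auto simp: walks_def length_Suc_conv)

text \<open>A walk is recovered from its initial part and its last step. This recursion reduces
  finiteness and the count of walks to inductions on \<open>n\<close>.\<close>

lemma walks_Suc:
  "walks (Suc n) = (\<lambda>(Y, e). Y @ [last Y + e]) ` (walks n \<times> unit_steps)"
proof (intro subset_antisym subsetI)
  fix Z :: "(int ^ 'd) list" assume Z: "Z \<in> walks (Suc n)"
  then obtain Y z where Y: "Z = Y @ [z]" "length Y = Suc n"
    by (metis (mono_tags, lifting) walks_def length_Suc_conv_rev mem_Collect_eq)
  have "Y \<in> walks n"
  proof -
    have "Z ! i = Y ! i" if "i \<le> n" for i
      using that Y by (simp add: nth_append)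
    from this[of 0] this[of "Suc _"] this show ?thesis
      using Z Y(2) by (auto simp: walks_def Suc_le_eq less_Suc_eq)
  qed
  moreover have "z - last Y \<in> unit_steps"
  proof -
    have "dist (lat (Z ! n)) (lat (Z ! Suc n)) = 1" using Z by (simp add: walks_def)
    then show ?thesis using Y by (cases Y rule: rev_cases) (auto simp: dist_lat_eq_1_iff nth_append)
  qed
  ultimately show "Z \<in> (\<lambda>(Y, e). Y @ [last Y + e]) ` (walks n \<times> unit_steps)"
    by (intro image_eqI[of _ _ "(Y, z - last Y)"]) (auto simp: Y)
next
  fix Z :: "(int ^ 'd) list"
  assume "Z \<in> (\<lambda>(Y, e). Y @ [last Y + e]) ` (walks n \<times> unit_steps)"
  then obtain Y e where Y: "Y \<in> walks n" "e \<in> unit_steps" "Z = Y @ [last Y + e]" by auto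
  have l: "length Y = Suc n" "last Y = Y ! n"
    using Y(1) by (auto simp: walks_def last_conv_nth simp flip: length_greater_0_conv)
  show "Z \<in> walks (Suc n)"
    using Y l by (auto simp: walks_def nth_append less_Suc_eq dist_lat_eq_1_iff)
qed

lemma finite_walks [simp]: "finite (walks n :: (int ^ 'd::finite) list set)"
  by (induction n) (simp_all add: walks_0 walks_Suc)

lemma card_walks: "card (walks n :: (int ^ 'd::finite) list set) = (2 * CARD('d)) ^ n"
proof (induction n)
  case (Suc n)
  have "inj_on (\<lambda>(Y, e). Y @ [last Y + e]) (walks n \<times> unit_steps :: ((int ^ 'd) list \<times> _) set)"
    by (auto simp: inj_on_def)
  then show ?case
    by (simp add: walks_Suc card_image card_cartesian_product Suc.IH card_unit_steps)
qed (simp add: walks_0)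

text \<open>The straight walk along a coordinate axis is self-avoiding. Hence \<open>c_n\<close> is
  nonzero and may serve as a normalisation.\<close>

lemma saws_nonempty: "(saws n :: (int ^ 'd::finite) list set) \<noteq> {}"
proof -
  fix i :: 'd
  let ?Y = "map (\<lambda>k. axis i (int k)) [0..<Suc n] :: (int ^ 'd) list"
  have *: "?Y ! k = axis i (int k)" if "k \<le> n" for k
    using that by (simp del: upt_Suc)
  have "axis i (int (Suc k)) - axis i (int k) = axis i 1" for k
    by (auto simp: axis_def vec_eq_iff)
  then have "dist (lat (?Y ! k)) (lat (?Y ! Suc k)) = 1" if "k < n" for k
    using that *[of k] *[of "Suc k"] by (auto simp: dist_lat_eq_1_iff unit_steps_eq simp del: upt_Suc of_nat_Suc)
  moreover have "?Y ! 0 = 0" using *[of 0] by (auto simp: axis_def vec_eq_iff simp del: upt_Suc)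
  moreover have "?Y ! k \<noteq> ?Y ! l" if "k \<le> n" "l \<le> n" "k \<noteq> l" for k l
    using that by (auto simp: * axis_eq_axis simp del: upt_Suc)
  ultimately have "?Y \<in> saws n"
    unfolding saws_def walks_def by (simp del: upt_Suc)
  then show ?thesis by blast
qed

lemma saws_subset_walks: "saws n \<subseteq> walks n"
  by (auto simp: saws_def)

lemma finite_saws [simp]: "finite (saws n :: (int ^ 'd::finite) list set)"
  by (rule finite_subset[OF saws_subset_walks finite_walks])

lemma visits_eq_card: "visits Y x = card {i. i < length Y \<and> Y ! i = x}"
  by (simp add: visits_def of_bool_def sum.If_cases Int_def)

lemma visits_pos: "x \<in> set Y \<Longrightarrow> visits Y x > 0"
  by (auto simp: visits_eq_card card_gt_0_iff in_set_conv_nth)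

text \<open>Double counting: every time index contributes to exactly one visited site. This is what
  lets a factor per visit be pulled out as one power common to all walks.\<close>

lemma sum_visits: "(\<Sum>x\<in>set Y. visits Y x) = length Y"
proof -
  have "(\<Sum>x\<in>set Y. visits Y x) = (\<Sum>i<length Y. \<Sum>x\<in>set Y. of_bool (Y ! i = x))"
    unfolding visits_def by (rule sum.swap)
  also have "\<dots> = (\<Sum>i<length Y. 1)"
    by (intro sum.cong refl) (simp add: of_bool_def)
  finally show ?thesis by simp
qed

text \<open>The weights see a walk only through its visit counts, so self-avoidance has to be read
  off from them.\<close>

lemma saws_iff_visits:
  assumes "Y \<in> walks n"
  shows "Y \<in> saws n \<longleftrightarrow> (\<forall>x\<in>set Y. visits Y x = 1)"
proof
  have len: "length Y = Suc n" using assms by (simp add: walks_def)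
  show "\<forall>x\<in>set Y. visits Y x = 1" if "Y \<in> saws n"
  proof
    fix x assume "x \<in> set Y"
    then obtain i where i: "i \<le> n" "Y ! i = x" by (auto simp: in_set_conv_nth len less_Suc_eq_le)
    then have "{i. i < length Y \<and> Y ! i = x} = {i}"
      using that by (auto simp: saws_def len less_Suc_eq_le)
    then show "visits Y x = 1" by (simp add: visits_eq_card)
  qed
  show "Y \<in> saws n" if v: "\<forall>x\<in>set Y. visits Y x = 1"
  proof -
    have "i = j" if "i \<le> n" "j \<le> n" "Y ! i = Y ! j" for i j
    proof -
      have "visits Y (Y ! i) = 1" using v that(1) len by simp
      then obtain k where "{l. l < length Y \<and> Y ! l = Y ! i} = {k}"
        unfolding visits_eq_card by (metis One_nat_def card_1_singletonE)
      then have "i = k" "j = k" using that len by (auto simp: set_eq_iff less_Suc_eq_le)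
      then show ?thesis by simp
    qed
    then show ?thesis using assms by (auto simp: saws_def)
  qed
qed

subsection \<open>Exponentially tilted Gaussian moments\<close>

text \<open>The factor of a site with \<open>k + 1\<close> visits, after the substitution
  \<open>s = a + u\<close>. The domain of integration no longer depends on \<open>a\<close>, which
  suits dominated convergence in \<open>a\<close>.\<close>

definition tilted_moment :: "nat \<Rightarrow> real \<Rightarrow> real" where
  "tilted_moment k a = (LINT s|lborel. indicator {0..} s * (s ^ k / fact k * exp (2 * a * s - s\<^sup>2)))"

lemma power_over_fact_le_exp:
  fixes x :: real
  assumes "0 \<le> x"
  shows "x ^ k / fact k \<le> exp x"
proof -
  have "(\<Sum>i\<in>{k}. x ^ i /\<^sub>R fact i) \<le> (\<Sum>i. x ^ i /\<^sub>R fact i)"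
    using assms by (intro sum_le_suminf sums_summable[OF exp_converges]) auto
  also have "\<dots> = exp x"
    by (rule sums_unique[symmetric, OF exp_converges])
  finally have "(\<Sum>i\<in>{k}. x ^ i /\<^sub>R fact i) \<le> exp x" .
  then show ?thesis by (simp add: field_simps)
qed

text \<open>Completing the square gives a multiple of the normal density with mean
  \<open>c / 2\<close> and variance \<open>1 / 2\<close>.\<close>

lemma integrable_exp_linear_minus_square: "integrable lborel (\<lambda>s::real. exp (c * s - s\<^sup>2))"
proof -
  have "exp (c * s - s\<^sup>2) = (sqrt pi * exp (c\<^sup>2 / 4)) * normal_density (c / 2) (sqrt (1 / 2)) s" for s
    by (simp add: normal_density_def exp_add[symmetric] power2_eq_square field_simps)
  then show ?thesis
    using integrable_normal_density[of "sqrt (1/2)" "c / 2"] by (simp only:) simp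
qed

lemma tilted_moment_eq: "exp (a\<^sup>2) * I_fun (Suc k) a = tilted_moment k a"
proof -
  have "tilted_moment k a =
      (LINT u|lborel. indicator {0..} (a + u) * ((a + u) ^ k / fact k * exp (2 * a * (a + u) - (a + u)\<^sup>2)))"
    unfolding tilted_moment_def by (subst lborel_integral_real_affine[of 1 _ a]) simp_all
  also have "\<dots> = (LINT u|lborel. exp (a\<^sup>2) *
      (indicator {- a..} u *\<^sub>R ((a + u) ^ (Suc k - 1) / fact (Suc k - 1) * exp (- u\<^sup>2))))"
  proof (intro Bochner_Integration.integral_cong refl)
    fix u
    have "2 * a * (a + u) - (a + u)\<^sup>2 = a\<^sup>2 + - u\<^sup>2" by (simp add: power2_eq_square algebra_simps)
    then show "indicator {0..} (a + u) * ((a + u) ^ k / fact k * exp (2 * a * (a + u) - (a + u)\<^sup>2)) =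
      exp (a\<^sup>2) * (indicator {- a..} u *\<^sub>R ((a + u) ^ (Suc k - 1) / fact (Suc k - 1) * exp (- u\<^sup>2)))"
      by (simp only: exp_add) (auto simp: indicator_def)
  qed
  finally show ?thesis
    unfolding I_fun_def set_lebesgue_integral_def by simp
qed

text \<open>For all \<open>a\<close> below \<open>b\<close> the majorant is the same function, as
  dominated convergence requires; \<open>b = a\<close> gives integrability.\<close>

lemma tilted_moment_integrand_bound:
  fixes s a b :: real
  shows "\<bar>indicator {0..} s * (s ^ k / fact k * exp (2 * a * s - s\<^sup>2))\<bar> \<le> exp ((1 + 2 * max a b) * s - s\<^sup>2)"
proof (cases "s \<ge> 0")
  case True
  have "s ^ k / fact k * exp (2 * a * s - s\<^sup>2) \<le> exp s * exp (2 * a * s - s\<^sup>2)"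
    using power_over_fact_le_exp[OF True, of k] by (intro mult_right_mono) auto
  also have "\<dots> \<le> exp ((1 + 2 * max a b) * s - s\<^sup>2)"
    using mult_right_mono[OF max.cobounded1[of a b] True]
    by (simp add: exp_add[symmetric] algebra_simps)
  finally show ?thesis using True by (simp add: abs_mult)
qed simp

lemma integrable_tilted_moment:
  fixes a :: real
  shows "integrable lborel (\<lambda>s. indicator {0..} s * (s ^ k / fact k * exp (2 * a * s - s\<^sup>2)))"
  by (rule Bochner_Integration.integrable_bound[OF integrable_exp_linear_minus_square[of "1 + 2 * max a a"]])
     (use tilted_moment_integrand_bound[of _ k a a] in auto)

lemma tilted_moment_pos: "tilted_moment k a > 0"
proof -
  let ?f = "\<lambda>s::real. indicator {0..} s * (s ^ k / fact k * exp (2 * a * s - s\<^sup>2))"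
  have nn: "?f s \<ge> 0" for s by (auto simp: indicator_def)
  have "tilted_moment k a \<noteq> 0"
  proof
    assume "tilted_moment k a = 0"
    then have "AE s in lborel. ?f s = 0"
      using integral_nonneg_eq_0_iff_AE[OF integrable_tilted_moment[of k a]] nn
      by (simp add: tilted_moment_def)
    \<comment> \<open>The integrand is strictly positive on the open unit interval, which has
      positive Lebesgue measure.\<close>
    then have "AE s in lborel. s \<notin> {0<..<1::real}"
      by (rule AE_mp) (auto intro!: AE_I2 simp: indicator_def)
    then have "{0<..<1::real} \<in> null_sets lborel"
      using AE_iff_null_sets[of "{0<..<1::real}" lborel] by simp
    then show False by (simp add: null_sets_def)
  qed
  moreover have "tilted_moment k a \<ge> 0"
    unfolding tilted_moment_def by (intro Bochner_Integration.integral_nonneg nn)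
  ultimately show ?thesis by simp
qed

lemma tendsto_tilted_moment:
  fixes f :: "real \<Rightarrow> real"
  assumes f: "(f \<longlongrightarrow> a) at_top"
  shows "((\<lambda>t. tilted_moment k (f t)) \<longlongrightarrow> tilted_moment k a) at_top"
  unfolding tilted_moment_def
proof (rule integral_dominated_convergence_at_top)
  show "integrable lborel (\<lambda>s. exp ((1 + 2 * (a + 1)) * s - s\<^sup>2))"
    by (rule integrable_exp_linear_minus_square)
  show "AE s in lborel. ((\<lambda>t. indicator {0..} s * (s ^ k / fact k * exp (2 * f t * s - s\<^sup>2)))
      \<longlongrightarrow> indicator {0..} s * (s ^ k / fact k * exp (2 * a * s - s\<^sup>2))) at_top"
    by (intro AE_I2 tendsto_intros f)
  have "eventually (\<lambda>t. f t < a + 1) at_top"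
    using order_tendstoD(2)[OF f, of "a + 1"] by simp
  then show "\<forall>\<^sub>F t in at_top. AE s in lborel.
      norm (indicator {0..} s * (s ^ k / fact k * exp (2 * f t * s - s\<^sup>2)))
        \<le> exp ((1 + 2 * (a + 1)) * s - s\<^sup>2)"
  proof eventually_elim
    case (elim t)
    then have "max (f t) (a + 1) = a + 1" by simp
    then show ?case
      using tilted_moment_integrand_bound[of _ k "f t" "a + 1"] by (intro AE_I2) auto
  qed
qed simp_all

section \<open>Asymptotics of the moments at plus and minus infinity\<close>

lemma exp_linear_minus_square_tendsto_0: "((\<lambda>t::real. exp (t - t\<^sup>2)) \<longlongrightarrow> 0) at_top"
proof (rule filterlim_compose[OF exp_at_bot])
  have "eventually (\<lambda>t::real. t - t\<^sup>2 \<le> - t) at_top"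
    using eventually_ge_at_top[of 2]
  proof eventually_elim
    case (elim t)
    then have "2 * t \<le> t * t" by (intro mult_right_mono) auto
    then show ?case by (simp add: power2_eq_square)
  qed
  then show "filterlim (\<lambda>t::real. t - t\<^sup>2) at_bot at_top"
    by (rule filterlim_at_bot_mono[OF filterlim_uminus_at_bot_at_top])
qed

text \<open>One factor \<open>exp (- t\<^sup>2)\<close> cancels the one gained by completing the
  square. For \<open>k = 0\<close> the full Gaussian integral remains in the limit; for larger
  \<open>k\<close> the leftover factors beat the growth of \<open>(t + u) ^ k\<close>.\<close>

lemma tilted_moment_at_top:
  "((\<lambda>t. exp (- t\<^sup>2) ^ Suc k * tilted_moment k t) \<longlongrightarrow> (if k = 0 then sqrt pi else 0)) at_top"
proof -
  let ?s = "\<lambda>t u::real. indicator {- t..} u * ((t + u) ^ k / fact k * exp (- u\<^sup>2) * exp (- t\<^sup>2) ^ k)"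
  let ?l = "\<lambda>u::real. if k = 0 then exp (- u\<^sup>2) else 0"
  \<comment> \<open>The first summand dominates the case \<open>k = 0\<close>, the second all
    others; its constant \<open>exp 1\<close> comes from
    \<open>t - t\<^sup>2 \<le> 1\<close>.\<close>
  let ?w = "\<lambda>u::real. exp (0 * u - u\<^sup>2) + exp 1 * exp (1 * u - u\<^sup>2)"
  have sq: "t - t\<^sup>2 \<le> 1" for t :: real
    using zero_le_power2[of "t - 1/2"] by (simp add: power2_eq_square algebra_simps)
  have bound: "\<bar>?s t u\<bar> \<le> exp (u - u\<^sup>2) * exp (t - t\<^sup>2)" if "k \<noteq> 0" for t u
  proof (cases "u \<ge> - t")
    case True
    \<comment> \<open>One of the \<open>k\<close> leftover Gaussian factors already suffices against
      \<open>exp (t + u)\<close>.\<close>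
    have "exp (- t\<^sup>2) ^ k \<le> exp (- t\<^sup>2) ^ 1"
      using that by (intro power_decreasing) auto
    then have "(t + u) ^ k / fact k * exp (- u\<^sup>2) * exp (- t\<^sup>2) ^ k
        \<le> exp (t + u) * exp (- u\<^sup>2) * exp (- t\<^sup>2)"
      using power_over_fact_le_exp[of "t + u" k] True by (intro mult_mono) auto
    also have "\<dots> = exp (u - u\<^sup>2) * exp (t - t\<^sup>2)" by (simp add: exp_add[symmetric])
    finally show ?thesis using True by (simp add: abs_mult)
  qed simp
  have eq: "exp (- t\<^sup>2) ^ Suc k * tilted_moment k t = (LINT u|lborel. ?s t u)" for t
  proof -
    have "exp (- t\<^sup>2) ^ Suc k * tilted_moment k t = exp (- t\<^sup>2) ^ k * I_fun (Suc k) t"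
      unfolding tilted_moment_eq[symmetric] by (simp add: exp_minus)
    also have "\<dots> = (LINT u|lborel. ?s t u)"
      unfolding I_fun_def set_lebesgue_integral_def
      by (subst integral_mult_right_zero[symmetric])
         (intro Bochner_Integration.integral_cong refl, simp)
    finally show ?thesis .
  qed
  have "((\<lambda>t. LINT u|lborel. ?s t u) \<longlongrightarrow> (LINT u|lborel. ?l u)) at_top"
  proof (rule integral_dominated_convergence_at_top)
    show "integrable lborel ?w"
      by (intro Bochner_Integration.integrable_add integrable_mult_right integrable_exp_linear_minus_square)
    show "AE u in lborel. ((\<lambda>t. ?s t u) \<longlongrightarrow> ?l u) at_top"
    proof (intro AE_I2)
      fix u :: real
      show "((\<lambda>t. ?s t u) \<longlongrightarrow> ?l u) at_top"
      proof (cases "k = 0")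
        case True
        have "eventually (\<lambda>t. ?s t u = ?l u) at_top"
          using eventually_ge_at_top[of "- u"] by eventually_elim (auto simp: True)
        then show ?thesis by (rule tendsto_eventually)
      next
        case False
        have "((\<lambda>t. exp (u - u\<^sup>2) * exp (t - t\<^sup>2)) \<longlongrightarrow> exp (u - u\<^sup>2) * 0) at_top"
          by (rule tendsto_mult[OF tendsto_const exp_linear_minus_square_tendsto_0])
        then have "((\<lambda>t. ?s t u) \<longlongrightarrow> 0) at_top"
          using bound[OF False]
          by (intro Lim_null_comparison[of "\<lambda>t. ?s t u" "\<lambda>t. exp (u - u\<^sup>2) * exp (t - t\<^sup>2)"]
              always_eventually) simp_all
        then show ?thesis using False by simp
      qed
    qed
    show "\<forall>\<^sub>F t in at_top. AE u in lborel. norm (?s t u) \<le> ?w u"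
    proof (intro always_eventually allI AE_I2)
      fix t u :: real
      show "norm (?s t u) \<le> ?w u"
      proof (cases "k = 0")
        case True
        then show ?thesis by (auto simp: indicator_def intro: add_increasing2)
      next
        case False
        have "\<bar>?s t u\<bar> \<le> exp (u - u\<^sup>2) * exp (t - t\<^sup>2)" by (rule bound[OF False])
        also have "\<dots> \<le> exp (u - u\<^sup>2) * exp 1" by (intro mult_left_mono) (auto simp: sq)
        also have "\<dots> \<le> ?w u" by simp
        finally show ?thesis by simp
      qed
    qed
  qed simp_all
  moreover have "(LINT u|lborel. exp (- u\<^sup>2)) = sqrt pi"
  proof -
    have "exp (- u\<^sup>2) = sqrt pi * normal_density 0 (sqrt (1 / 2)) u" for u
      by (simp add: normal_density_def)
    then show ?thesis using integral_normal_density[of "sqrt (1/2)" 0] by simp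
  qed
  ultimately show ?thesis unfolding eq by (cases "k = 0") simp_all
qed

text \<open>Substituting \<open>s = v / (2 * t)\<close> turns the tilt into
  \<open>exp (- v)\<close>. The result is the mean of \<open>exp (- (v / (2 * t))\<^sup>2)\<close>
  under an Erlang law independent of \<open>t\<close>, and this tends to its total mass.\<close>

lemma tilted_moment_at_bot:
  "((\<lambda>t. (2 * t) ^ Suc k * tilted_moment k (- t)) \<longlongrightarrow> 1) at_top"
proof -
  let ?s = "\<lambda>t v. erlang_density k 1 v * exp (- (v / (2 * t))\<^sup>2)"
  interpret E: prob_space "density lborel (erlang_density k 1)"
    by (rule prob_space_erlang_density) simp
  have eq: "(2 * t) ^ Suc k * tilted_moment k (- t) = (LINT v|lborel. ?s t v)" if "t > 0" for t
  proof -
    define F where "F v = indicator {0..} (v / (2 * t)) *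
        ((v / (2 * t)) ^ k / fact k * exp (- v - (v / (2 * t))\<^sup>2))" for v
    have "tilted_moment k (- t) = (1 / (2 * t)) * (LINT v|lborel. F v)"
      unfolding tilted_moment_def F_def
      using that by (subst lborel_integral_real_affine[of "1 / (2 * t)" _ 0]) (simp_all add: field_simps)
    \<comment> \<open>One of the \<open>Suc k\<close> factors cancels the Jacobian; the other
      \<open>k\<close> undo the scaling of \<open>s ^ k\<close>.\<close>
    then have "(2 * t) ^ Suc k * tilted_moment k (- t) = (LINT v|lborel. (2 * t) ^ k * F v)"
      using that by simp
    also have "(LINT v|lborel. (2 * t) ^ k * F v) = (LINT v|lborel. ?s t v)"
    proof (rule Bochner_Integration.integral_cong[OF refl])
      fix v :: real
      have p: "(2 * t) ^ k * (v / (2 * t)) ^ k = v ^ k"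
        using that by (subst power_mult_distrib[symmetric]) simp
      have e: "exp (- v - (v / (2 * t))\<^sup>2) = exp (- v) * exp (- (v / (2 * t))\<^sup>2)"
        by (simp add: exp_add[symmetric])
      show "(2 * t) ^ k * F v = ?s t v"
      proof (cases "v < 0")
        case True
        then show ?thesis using that by (simp add: F_def erlang_density_def indicator_def zero_le_divide_iff)
      next
        case False
        then have "(2 * t) ^ k * F v = (2 * t) ^ k * (v / (2 * t)) ^ k / fact k * exp (- v - (v / (2 * t))\<^sup>2)"
          using that by (simp add: F_def)
        also have "\<dots> = ?s t v"
          unfolding p e using False by (simp add: erlang_density_def)
        finally show ?thesis .
      qed
    qed
    finally show ?thesis .
  qed
  have i: "integrable lborel (erlang_density k 1)" and i1: "(LINT v|lborel. erlang_density k 1 v) = 1"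
    using E.integrable_const[of "1::real"] E.prob_space
    by (subst (asm) integrable_real_density, simp_all)
       (subst (asm) measure_def, simp add: emeasure_density integral_eq_nn_integral)
  have "((\<lambda>t. LINT v|lborel. ?s t v) \<longlongrightarrow> (LINT v|lborel. erlang_density k 1 v)) at_top"
  proof (rule integral_dominated_convergence_at_top)
    show "AE v in lborel. ((\<lambda>t. ?s t v) \<longlongrightarrow> erlang_density k 1 v) at_top"
    proof (intro AE_I2)
      fix v :: real
      have "((\<lambda>t. v / (2 * t)) \<longlongrightarrow> 0) at_top"
        by (intro real_tendsto_divide_at_top[OF tendsto_const] filterlim_tendsto_pos_mult_at_top[OF tendsto_const])
           (auto simp: filterlim_ident)
      then have "((\<lambda>t. ?s t v) \<longlongrightarrow> erlang_density k 1 v * exp (- 0\<^sup>2)) at_top"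
        by (intro tendsto_intros)
      then show "((\<lambda>t. ?s t v) \<longlongrightarrow> erlang_density k 1 v) at_top" by simp
    qed
    show "\<forall>\<^sub>F t in at_top. AE v in lborel. norm (?s t v) \<le> erlang_density k 1 v"
      by (intro always_eventually allI AE_I2) (auto simp: abs_mult intro!: mult_left_le)
  qed (use i in auto)
  then have "((\<lambda>t. LINT v|lborel. ?s t v) \<longlongrightarrow> 1) at_top" by (simp add: i1)
  moreover have "eventually (\<lambda>t. (LINT v|lborel. ?s t v) = (2 * t) ^ Suc k * tilted_moment k (- t)) at_top"
    using eventually_gt_at_top[of 0] by eventually_elim (rule eq[symmetric])
  ultimately show ?thesis by (rule Lim_transform_eventually)
qed

subsection \<open>Local times\<close>

text \<open>The local times must be evaluated at every sample point, including the null set where some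
  holding times are negative, because the infinite sums in \<open>weight\<close> have to be shown measurable.
  At an arbitrary sample point the walk sits at its \<open>k\<close>-th site exactly between consecutive
  running maxima of the jump times, and \<open>sojourn n \<tau> k\<close> is the length of that interval
  cut off at the time of the \<open>(n + 1)\<close>st jump.\<close>

primrec run_max :: "(nat \<Rightarrow> real) \<Rightarrow> nat \<Rightarrow> real" where
  "run_max \<tau> 0 = 0"
| "run_max \<tau> (Suc k) = max (run_max \<tau> k) (\<Sum>i\<le>k. \<tau> i)"

definition sojourn :: "nat \<Rightarrow> (nat \<Rightarrow> real) \<Rightarrow> nat \<Rightarrow> real" where
  "sojourn n \<tau> k = min (run_max \<tau> (Suc k)) (\<Sum>i\<le>n. \<tau> i) - min (run_max \<tau> k) (\<Sum>i\<le>n. \<tau> i)"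

lemma run_max_mono: "j \<le> k \<Longrightarrow> run_max \<tau> j \<le> run_max \<tau> k"
  by (induction k) (auto simp: le_Suc_eq max.coboundedI1)

lemma sum_le_run_max: "j < k \<Longrightarrow> (\<Sum>i\<le>j. \<tau> i) \<le> run_max \<tau> k"
  using run_max_mono[of "Suc j" k \<tau>] by simp

text \<open>With nonnegative holding times the jump times increase, so they are their own running
  maxima and the cut-off does not bite up to index \<open>n\<close>.\<close>

lemma sojourn_eq_holding_time:
  assumes "\<And>i. i \<le> n \<Longrightarrow> \<tau> i \<ge> 0" "k \<le> n"
  shows "sojourn n \<tau> k = \<tau> k"
proof -
  have r: "run_max \<tau> j = (\<Sum>i<j. \<tau> i)" if "j \<le> Suc n" for j
    using that assms(1) by (induction j) (simp_all flip: lessThan_Suc_atMost)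
  have "(\<Sum>i<j. \<tau> i) \<le> (\<Sum>i\<le>n. \<tau> i)" if "j \<le> Suc n" for j
    using that assms(1) by (intro sum_mono2) auto
  from this[of k] this[of "Suc k"] show ?thesis
    using assms(2) by (simp add: sojourn_def r del: run_max.simps)
qed

text \<open>Such an \<open>s\<close> is at or beyond all jump times of index below \<open>k\<close>,
  while only the one of index \<open>k\<close> can have raised the maximum above
  \<open>s\<close>.\<close>

lemma ctrw_eq_jump_chain:
  assumes "run_max (fst \<omega>) k \<le> s" "s < run_max (fst \<omega>) (Suc k)"
  shows "ctrw s \<omega> = jump_chain k \<omega>"
proof -
  have "(LEAST k. s < jump_time k \<omega>) = k"
  proof (rule Least_equality)
    show "s < jump_time k \<omega>"
      using assms by (auto simp: jump_time_def max_def split: if_splits)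
    fix j assume j: "s < jump_time j \<omega>"
    show "k \<le> j"
    proof (rule ccontr)
      assume "\<not> k \<le> j"
      then show False
        using j assms(1) sum_le_run_max[of j k "fst \<omega>"] by (simp add: jump_time_def)
    qed
  qed
  then show ?thesis by (simp add: ctrw_def)
qed

text \<open>The points \<open>?p k\<close> cut the time interval into pieces on which the walk
  stands still. The identity holds at every sample point, so measurability can be read off from
  it.\<close>

lemma local_time_eq:
  "local_time x n \<omega> = (\<Sum>k\<le>n. of_bool (jump_chain k \<omega> = x) * sojourn n (fst \<omega>) k)"
proof -
  let ?T = "\<Sum>i\<le>n. fst \<omega> i"
  let ?p = "\<lambda>k. min (run_max (fst \<omega>) k) ?T"
  let ?f = "\<lambda>s. of_bool (ctrw s \<omega> = x) :: real"
  have mono: "?p k \<le> ?p (Suc k)" for k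
    using run_max_mono[of k "Suc k" "fst \<omega>"] by (intro min.mono) auto
  have nn: "0 \<le> run_max (fst \<omega>) k" for k
    using run_max_mono[of 0 k "fst \<omega>"] by simp
  have piece: "indicator {?p k..<?p (Suc k)} s * ?f s
      = indicator {?p k..<?p (Suc k)} s * of_bool (jump_chain k \<omega> = x)" for k s
  proof (cases "s \<in> {?p k..<?p (Suc k)}")
    case True
    then have "run_max (fst \<omega>) k \<le> s" "s < run_max (fst \<omega>) (Suc k)"
      by (auto simp: min_def split: if_splits simp del: run_max.simps)
    then show ?thesis by (simp add: ctrw_eq_jump_chain)
  qed simp
  have split: "indicator {0..<?p m} s * ?f s
      = (\<Sum>k<m. indicator {?p k..<?p (Suc k)} s * of_bool (jump_chain k \<omega> = x))" for m s
  proof (induction m)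
    case 0
    then show ?case by simp
  next
    case (Suc m)
    \<comment> \<open>A negative cut point forces a negative final time; then all cut points
      coincide and every piece is empty.\<close>
    have "?p m < 0 \<Longrightarrow> ?T < 0 \<and> ?p m = ?T \<and> ?p (Suc m) = ?T"
      using nn[of m] nn[of "Suc m"] by (auto simp: min_def simp del: run_max.simps)
    then have "indicator {0..<?p (Suc m)} s = indicator {0..<?p m} s + (indicator {?p m..<?p (Suc m)} s :: real)"
      using mono[of m] by (cases "?p m < 0") (auto simp: indicator_def simp del: run_max.simps)
    then have "indicator {0..<?p (Suc m)} s * ?f s
        = indicator {0..<?p m} s * ?f s + indicator {?p m..<?p (Suc m)} s * ?f s"
      by (simp only: distrib_right)
    then show ?case by (simp only: Suc.IH piece sum.lessThan_Suc)
  qed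
  \<comment> \<open>The final time is among the jump times entering \<open>run_max\<close> at
    \<open>Suc n\<close>. The closed interval has one extra point there, of measure zero.\<close>
  have "?p (Suc n) = ?T" by simp
  then have "indicator {0..jump_time n \<omega>} s *\<^sub>R ?f s =
      (\<Sum>k<Suc n. indicator {?p k..<?p (Suc k)} s * of_bool (jump_chain k \<omega> = x))
      + indicator {?T} s * (indicator {0..?T} ?T * ?f ?T)" for s
    unfolding split[symmetric] jump_time_def
    by (cases "s = ?T") (auto simp: indicator_def simp del: run_max.simps)
  then have "local_time x n \<omega> = (LINT s|lborel.
      (\<Sum>k<Suc n. indicator {?p k..<?p (Suc k)} s * of_bool (jump_chain k \<omega> = x))
      + indicator {?T} s * (indicator {0..?T} ?T * ?f ?T))"
    unfolding local_time_def set_lebesgue_integral_def by (simp only:)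
  also have "\<dots> = (\<Sum>k<Suc n. (?p (Suc k) - ?p k) * of_bool (jump_chain k \<omega> = x))"
    using mono by (subst Bochner_Integration.integral_add)
       (auto intro!: integrable_mult_left Bochner_Integration.integrable_sum
             simp: Bochner_Integration.integral_sum integrable_mult_left simp del: run_max.simps sum.lessThan_Suc)
  finally show ?thesis
    by (simp add: sojourn_def lessThan_Suc_atMost mult.commute del: run_max.simps)
qed

text \<open>Only the finitely many sites \<open>c k\<close> contribute. Expanding the square leaves
  the pairs of times spent at a common site, a finite expression with no sum over the
  lattice.\<close>

lemma infsum_weighted_occupation:
  fixes D :: "nat \<Rightarrow> real" and c :: "nat \<Rightarrow> 'a"
  shows "(\<Sum>\<^sub>\<infinity>x\<in>UNIV. \<Sum>k\<le>n. of_bool (c k = x) * D k) = (\<Sum>k\<le>n. D k)"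
    and "(\<Sum>\<^sub>\<infinity>x\<in>UNIV. (\<Sum>k\<le>n. of_bool (c k = x) * D k)\<^sup>2)
      = (\<Sum>k\<le>n. \<Sum>l\<le>n. of_bool (c k = c l) * (D k * D l))"
proof -
  let ?F = "c ` {..n}"
  have "(\<Sum>\<^sub>\<infinity>x\<in>UNIV. \<Sum>k\<le>n. of_bool (c k = x) * D k) = (\<Sum>\<^sub>\<infinity>x\<in>?F. \<Sum>k\<le>n. of_bool (c k = x) * D k)"
    by (rule infsum_cong_neutral) (auto intro!: sum.neutral)
  also have "\<dots> = (\<Sum>x\<in>?F. \<Sum>k\<le>n. of_bool (c k = x) * D k)"
    by simp
  also have "\<dots> = (\<Sum>k\<le>n. \<Sum>x\<in>?F. of_bool (c k = x) * D k)"
    by (rule sum.swap)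
  also have "\<dots> = (\<Sum>k\<le>n. D k)"
    by (intro sum.cong refl) (simp add: sum_distrib_right[symmetric] of_bool_def)
  finally show "(\<Sum>\<^sub>\<infinity>x\<in>UNIV. \<Sum>k\<le>n. of_bool (c k = x) * D k) = (\<Sum>k\<le>n. D k)" .
  have "(\<Sum>\<^sub>\<infinity>x\<in>UNIV. (\<Sum>k\<le>n. of_bool (c k = x) * D k)\<^sup>2) = (\<Sum>\<^sub>\<infinity>x\<in>?F. (\<Sum>k\<le>n. of_bool (c k = x) * D k)\<^sup>2)"
    by (rule infsum_cong_neutral) (auto intro!: sum.neutral)
  also have "\<dots> = (\<Sum>x\<in>?F. (\<Sum>k\<le>n. of_bool (c k = x) * D k)\<^sup>2)"
    by simp
  also have "\<dots> = (\<Sum>x\<in>?F. \<Sum>k\<le>n. \<Sum>l\<le>n. of_bool (c k = x) * (of_bool (c k = c l) * (D k * D l)))"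
    unfolding power2_eq_square sum_product by (intro sum.cong refl) auto
  also have "\<dots> = (\<Sum>k\<le>n. \<Sum>x\<in>?F. \<Sum>l\<le>n. of_bool (c k = x) * (of_bool (c k = c l) * (D k * D l)))"
    by (rule sum.swap)
  also have "\<dots> = (\<Sum>k\<le>n. \<Sum>x\<in>?F. of_bool (c k = x) * (\<Sum>l\<le>n. of_bool (c k = c l) * (D k * D l)))"
    by (simp only: sum_distrib_left)
  also have "\<dots> = (\<Sum>k\<le>n. \<Sum>l\<le>n. of_bool (c k = c l) * (D k * D l))"
    by (intro sum.cong refl) (simp only: sum_distrib_right[symmetric], simp add: of_bool_def)
  finally show "(\<Sum>\<^sub>\<infinity>x\<in>UNIV. (\<Sum>k\<le>n. of_bool (c k = x) * D k)\<^sup>2)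
      = (\<Sum>k\<le>n. \<Sum>l\<le>n. of_bool (c k = c l) * (D k * D l))" .
qed

lemma borel_measurable_run_max [measurable]:
  assumes [measurable]: "\<And>i. (\<lambda>\<omega>. \<tau> \<omega> i) \<in> borel_measurable M"
  shows "(\<lambda>\<omega>. run_max (\<tau> \<omega>) k) \<in> borel_measurable M"
  by (induction k) simp_all

lemma borel_measurable_sojourn [measurable]:
  assumes [measurable]: "\<And>i. (\<lambda>\<omega>. \<tau> \<omega> i) \<in> borel_measurable M"
  shows "(\<lambda>\<omega>. sojourn n (\<tau> \<omega>) k) \<in> borel_measurable M"
  unfolding sojourn_def by measurable

subsection \<open>Holding times conditioned on the walk\<close>

abbreviation exp_measure :: "real measure" where
  "exp_measure \<equiv> density lborel (\<lambda>t. ennreal (exponential_density 1 t))"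

abbreviation holding_space :: "(nat \<Rightarrow> real) measure" where
  "holding_space \<equiv> \<Pi>\<^sub>M i\<in>(UNIV::nat set). exp_measure"

abbreviation step_space :: "(nat \<Rightarrow> int ^ 'd::finite) measure" where
  "step_space \<equiv> \<Pi>\<^sub>M i\<in>(UNIV::nat set). measure_pmf (pmf_of_set unit_steps)"

lemma prob_space_exp_measure: "prob_space exp_measure"
  by (simp add: prob_space_exponential_density)

lemma measurable_fst_ctrw_space [measurable]: "fst \<in> measurable ctrw_space holding_space"
  and measurable_snd_ctrw_space [measurable]: "snd \<in> measurable ctrw_space step_space"
  unfolding ctrw_space_def by simp_all

lemma borel_measurable_holding_time [measurable]:
  "(\<lambda>\<tau>. \<tau> i) \<in> borel_measurable holding_space"
  using measurable_component_singleton[of i UNIV "\<lambda>_. exp_measure"] by simp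

lemma measurable_step_sum [measurable]:
  "(\<lambda>s. \<Sum>i<k. s i) \<in> measurable (step_space :: (nat \<Rightarrow> int ^ 'd::finite) measure) (count_space UNIV)"
proof (induction k)
  case (Suc k)
  have "(\<lambda>s. s k) \<in> measurable (step_space :: (nat \<Rightarrow> int ^ 'd) measure) (count_space UNIV)"
    using measurable_component_singleton[of k UNIV "\<lambda>_. measure_pmf (pmf_of_set unit_steps)"]
    by (simp cong: measurable_cong_sets)
  note [measurable] = this Suc.IH
  \<comment> \<open>The lattice is countable, so measurability may be checked for each fixed value
    \<open>v\<close> of the partial sum.\<close>
  have "(\<lambda>s. (\<lambda>v s. v + s k) (\<Sum>i<k. s i) s) \<in> measurable (step_space :: (nat \<Rightarrow> int ^ 'd) measure) (count_space UNIV)"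
    by (rule measurable_compose_countable[where g="\<lambda>s. \<Sum>i<k. s i"])
       (auto intro: measurable_compose[of "\<lambda>s. s k" _ "count_space UNIV"] Suc.IH)
  then show ?case by simp
qed simp

lemma measurable_jump_chain [measurable]:
  "jump_chain k \<in> measurable ctrw_space (count_space UNIV)"
  unfolding jump_chain_def[abs_def]
  by (rule measurable_compose[OF measurable_snd_ctrw_space measurable_step_sum])

text \<open>Telescoping shows that the conditioning event constrains just the first \<open>n\<close>
  steps, hence is a rectangle in the product space.\<close>

lemma jump_chain_event_eq:
  assumes "Y \<in> walks n"
  shows "(\<forall>i\<le>n. jump_chain i \<omega> = Y ! i) \<longleftrightarrow> (\<forall>i\<in>{..<n}. snd \<omega> i \<in> {Y ! Suc i - Y ! i})"
proof
  assume *: "\<forall>i\<le>n. jump_chain i \<omega> = Y ! i"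
  show "\<forall>i\<in>{..<n}. snd \<omega> i \<in> {Y ! Suc i - Y ! i}"
  proof
    fix i assume "i \<in> {..<n}"
    then have "jump_chain (Suc i) \<omega> = Y ! Suc i" "jump_chain i \<omega> = Y ! i"
      using * by auto
    then show "snd \<omega> i \<in> {Y ! Suc i - Y ! i}" by (auto simp: jump_chain_def algebra_simps)
  qed
next
  assume *: "\<forall>i\<in>{..<n}. snd \<omega> i \<in> {Y ! Suc i - Y ! i}"
  have "jump_chain i \<omega> = Y ! i" if "i \<le> n" for i
    using that
  proof (induction i)
    case 0
    then show ?case using assms by (simp add: jump_chain_def walks_def)
  next
    case (Suc i)
    then have "snd \<omega> i = Y ! Suc i - Y ! i" "jump_chain i \<omega> = Y ! i" using * by auto
    then show ?case by (simp add: jump_chain_def)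
  qed
  then show "\<forall>i\<le>n. jump_chain i \<omega> = Y ! i" by simp
qed

lemma emeasure_steps_pos:
  fixes e :: "nat \<Rightarrow> int ^ 'd::finite"
  assumes "\<And>i. i < n \<Longrightarrow> e i \<in> unit_steps"
  shows "emeasure step_space {s \<in> space step_space. \<forall>i\<in>{..<n}. s i \<in> {e i}} \<noteq> 0"
proof -
  interpret product_prob_space "\<lambda>_::nat. measure_pmf (pmf_of_set (unit_steps :: (int ^ 'd) set))" UNIV ..
  have "emeasure step_space {s \<in> space step_space. \<forall>i\<in>{..<n}. s i \<in> {e i}}
      = (\<Prod>i<n. emeasure (measure_pmf (pmf_of_set unit_steps)) {e i})"
    by (rule emeasure_PiM_Collect) auto
  also have "\<dots> = (\<Prod>i<n. ennreal (1 / card (unit_steps :: (int ^ 'd) set)))"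
    using assms by (intro prod.cong) (auto simp: emeasure_pmf_single)
  also have "\<dots> = ennreal (1 / card (unit_steps :: (int ^ 'd) set)) ^ n"
    by simp
  also have "\<dots> \<noteq> 0"
    by (simp add: card_gt_0_iff)
  finally show ?thesis .
qed

text \<open>The event is the whole holding space times a step event of positive probability. That
  probability factors out of numerator and denominator and cancels.\<close>

lemma distr_holding_times_given_walk:
  fixes Y :: "(int ^ 'd::finite) list"
  assumes "Y \<in> walks n"
  shows "distr (uniform_measure ctrw_space {\<omega> \<in> space ctrw_space. \<forall>i\<le>n. jump_chain i \<omega> = Y ! i})
      holding_space fst = holding_space"
    (is "distr (uniform_measure _ ?A) _ _ = _")
proof (rule measure_eqI)
  interpret H: prob_space holding_space by (rule prob_space_PiM) (rule prob_space_exp_measure)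
  interpret S: prob_space "step_space :: (nat \<Rightarrow> int ^ 'd) measure"
    by (rule prob_space_PiM) (rule prob_space_measure_pmf)
  let ?B = "{s \<in> space step_space. \<forall>i\<in>{..<n}. s i \<in> {Y ! Suc i - Y ! i}}"
  have A: "?A = space holding_space \<times> ?B"
    unfolding jump_chain_event_eq[OF assms] by (auto simp: ctrw_space_def space_pair_measure)
  have As: "?A \<in> sets ctrw_space" by measurable
  have B: "?B \<in> sets step_space"
    by (intro sets.sets_Collect_finite_All sets_Collect_single') auto
  fix C assume "C \<in> sets (distr (uniform_measure ctrw_space ?A) holding_space fst)"
  then have C: "C \<in> sets holding_space" by simp
  have "emeasure (distr (uniform_measure ctrw_space ?A) holding_space fst) C
      = emeasure ctrw_space (?A \<inter> (fst -` C \<inter> space ctrw_space)) / emeasure ctrw_space ?A"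
    using C As
    by (subst emeasure_distr)
       (auto cong: measurable_cong_sets intro!: emeasure_uniform_measure)
  also have "?A \<inter> (fst -` C \<inter> space ctrw_space) = C \<times> ?B"
    using sets.sets_into_space[OF C] unfolding A by (auto simp: ctrw_space_def space_pair_measure)
  also have "emeasure ctrw_space (C \<times> ?B) / emeasure ctrw_space ?A
      = emeasure holding_space C * emeasure step_space ?B / emeasure step_space ?B"
  proof -
    have "emeasure ctrw_space (D \<times> ?B) = emeasure holding_space D * emeasure step_space ?B"
      if "D \<in> sets holding_space" for D
      unfolding ctrw_space_def by (rule S.emeasure_pair_measure_Times[OF that B])
    from this[OF C] this[OF sets.top] show ?thesis
      by (simp only: A H.emeasure_space_1 mult_1_left)
  qed
  also have "\<dots> = emeasure holding_space C"
    using emeasure_steps_pos[of n "\<lambda>i. Y ! Suc i - Y ! i"] assms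
    by (simp add: walks_def dist_lat_eq_1_iff ennreal_mult_divide_eq S.emeasure_eq_measure)
  finally show "emeasure (distr (uniform_measure ctrw_space ?A) holding_space fst) C
      = emeasure holding_space C" .
qed simp

lemma AE_holding_time_nonneg: "AE \<tau> in holding_space. \<forall>i. 0 \<le> \<tau> i"
proof (subst AE_all_countable, intro allI)
  fix i
  have "AE t in exp_measure. 0 \<le> t"
    by (subst AE_density) (auto intro!: AE_I2 simp: exponential_density_def)
  then show "AE \<tau> in holding_space. 0 \<le> \<tau> i"
    by (intro AE_PiM_component prob_space_exp_measure) auto
qed

lemma indep_vars_holding_times: "prob_space.indep_vars holding_space (\<lambda>_. borel) (\<lambda>i \<tau>. \<tau> i) UNIV"
  and distributed_holding_time:
    "distributed holding_space lborel (\<lambda>\<tau>. \<tau> i) (\<lambda>t. ennreal (exponential_density 1 t))"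
proof -
  interpret H: prob_space holding_space by (rule prob_space_PiM) (rule prob_space_exp_measure)
  have comp: "distr holding_space borel (\<lambda>\<tau>. \<tau> i) = exp_measure" for i
    using distr_PiM_component[of UNIV "\<lambda>_. exp_measure" i, OF prob_space_exp_measure]
    by (simp cong: distr_cong)
  have "distr holding_space (\<Pi>\<^sub>M i\<in>UNIV. borel) (\<lambda>\<tau>. \<lambda>i\<in>UNIV. \<tau> i) = distr holding_space holding_space (\<lambda>\<tau>. \<tau>)"
    by (intro distr_cong sets_PiM_cong) auto
  then show "H.indep_vars (\<lambda>_. borel) (\<lambda>i \<tau>. \<tau> i) UNIV"
    by (subst H.indep_vars_iff_distr_eq_PiM') (simp_all add: comp)
  have "distr holding_space lborel (\<lambda>\<tau>. \<tau> i) = distr holding_space borel (\<lambda>\<tau>. \<tau> i)"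
    by (intro distr_cong) auto
  then show "distributed holding_space lborel (\<lambda>\<tau>. \<tau> i) (\<lambda>t. ennreal (exponential_density 1 t))"
    by (simp add: distributed_def comp)
qed

section \<open>Gaussian-penalised Erlang integrals and the product formula\<close>

lemma alpha_eq: "g > 0 \<Longrightarrow> 2 * alpha g \<rho> = (\<rho> - 1) / sqrt g"
  by (simp add: alpha_def powr_minus_divide powr_half_sqrt field_simps)

text \<open>Rescale by \<open>l = s / sqrt g\<close>. The Erlang factor \<open>exp (- l)\<close>
  lowers \<open>\<rho>\<close> to \<open>\<rho> - 1\<close>, which is why \<open>alpha\<close> has
  this form.\<close>

lemma erlang_gaussian_integral:
  assumes "g > 0"
  shows "(LINT l|lborel. erlang_density k 1 l * exp (- g * l\<^sup>2 + \<rho> * l))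
    = (1 / sqrt g) ^ Suc k * tilted_moment k (alpha g \<rho>)"
proof -
  let ?r = "1 / sqrt g"
  have r: "?r > 0" "g * ?r\<^sup>2 = 1" using assms by (simp_all add: power_divide)
  have "(LINT l|lborel. erlang_density k 1 l * exp (- g * l\<^sup>2 + \<rho> * l))
    = ?r * (LINT s|lborel. erlang_density k 1 (?r * s) * exp (- g * (?r * s)\<^sup>2 + \<rho> * (?r * s)))"
    using r by (subst lborel_integral_real_affine[of ?r _ 0]) simp_all
  also have "(LINT s|lborel. erlang_density k 1 (?r * s) * exp (- g * (?r * s)\<^sup>2 + \<rho> * (?r * s)))
    = (LINT s|lborel. ?r ^ k * (indicator {0..} s * (s ^ k / fact k * exp (2 * alpha g \<rho> * s - s\<^sup>2))))"
  proof (rule Bochner_Integration.integral_cong[OF refl])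
    fix s :: real
    have "- g * (?r * s)\<^sup>2 = - ((g * ?r\<^sup>2) * s\<^sup>2)" by (simp only: power_mult_distrib mult_minus_left mult.assoc)
    then have "- g * (?r * s)\<^sup>2 = - s\<^sup>2" using r by simp
    moreover have "2 * alpha g \<rho> * s - s\<^sup>2 = - (?r * s) + (- s\<^sup>2 + \<rho> * (?r * s))"
      unfolding alpha_eq[OF assms] by (simp add: algebra_simps diff_divide_distrib)
    ultimately have e: "exp (2 * alpha g \<rho> * s - s\<^sup>2)
        = exp (- (?r * s)) * exp (- g * (?r * s)\<^sup>2 + \<rho> * (?r * s))"
      by (simp only: exp_add)
    have neg: "?r * s < 0 \<longleftrightarrow> s < 0" using r by (simp only: mult_less_0_iff) auto
    show "erlang_density k 1 (?r * s) * exp (- g * (?r * s)\<^sup>2 + \<rho> * (?r * s))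
      = ?r ^ k * (indicator {0..} s * (s ^ k / fact k * exp (2 * alpha g \<rho> * s - s\<^sup>2)))"
      unfolding e erlang_density_def neg power_mult_distrib[of ?r s k]
      by (cases "s < 0") simp_all
  qed
  also have "\<dots> = ?r ^ k * tilted_moment k (alpha g \<rho>)"
    by (simp only: integral_mult_right_zero tilted_moment_def)
  finally show ?thesis by simp
qed

text \<open>Distinct sites use disjoint sets of holding times, so the expectation of the product
  splits; each occupation sum is Erlang distributed.\<close>

lemma expectation_occupation_product:
  fixes Y :: "'a list"
  assumes "g > 0"
  shows "(LINT \<tau>|holding_space. (\<Prod>x\<in>set Y.
      exp (- g * (\<Sum>k | k < length Y \<and> Y ! k = x. \<tau> k)\<^sup>2 + \<rho> * (\<Sum>k | k < length Y \<and> Y ! k = x. \<tau> k))))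
    = (\<Prod>x\<in>set Y. (1 / sqrt g) ^ card {k. k < length Y \<and> Y ! k = x}
        * tilted_moment (card {k. k < length Y \<and> Y ! k = x} - 1) (alpha g \<rho>))"
proof -
  interpret H: prob_space holding_space by (rule prob_space_PiM) (rule prob_space_exp_measure)
  let ?K = "\<lambda>x. {k. k < length Y \<and> Y ! k = x}"
  let ?h = "\<lambda>l::real. exp (- g * l\<^sup>2 + \<rho> * l)"
  have "disjoint_family_on ?K (set Y)" by (auto simp: disjoint_family_on_def)
  then have "H.indep_vars (\<lambda>x. PiM (?K x) (\<lambda>_. borel)) (\<lambda>x \<tau>. restrict (\<lambda>i. \<tau> i) (?K x)) (set Y)"
    by (intro H.indep_vars_restrict[OF indep_vars_holding_times]) auto
  then have "H.indep_vars (\<lambda>_. borel) (\<lambda>x \<tau>. ?h (\<Sum>k\<in>?K x. restrict (\<lambda>i. \<tau> i) (?K x) k)) (set Y)"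
    by (rule H.indep_vars_compose2) measurable
  moreover have "(\<Sum>k\<in>?K x. restrict (\<lambda>i. \<tau> i) (?K x) k) = (\<Sum>k\<in>?K x. \<tau> k)" for x and \<tau> :: "nat \<Rightarrow> real"
    by (intro sum.cong) auto
  ultimately have ind: "H.indep_vars (\<lambda>_. borel) (\<lambda>x \<tau>. ?h (\<Sum>k\<in>?K x. \<tau> k)) (set Y)"
    by (simp only:)
  \<comment> \<open>The maximum of the quadratic exponent, attained at
    \<open>l = \<rho> / (2 * g)\<close>; boundedness yields integrability.\<close>
  have h_le: "?h l \<le> exp (\<rho>\<^sup>2 / (4 * g))" for l
  proof -
    have "\<rho>\<^sup>2 / (4 * g) - (- g * l\<^sup>2 + \<rho> * l) = g * (l - \<rho> / (2 * g))\<^sup>2"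
      using assms by (simp add: power2_eq_square field_simps)
    moreover have "\<dots> \<ge> 0" using assms by simp
    ultimately show ?thesis by simp
  qed
  have "integrable holding_space (\<lambda>\<tau>. ?h (\<Sum>k\<in>?K x. \<tau> k))" for x
    by (rule H.integrable_const_bound[of _ "exp (\<rho>\<^sup>2 / (4 * g))"]) (use h_le in auto)
  then have "(LINT \<tau>|holding_space. (\<Prod>x\<in>set Y. ?h (\<Sum>k\<in>?K x. \<tau> k)))
      = (\<Prod>x\<in>set Y. LINT \<tau>|holding_space. ?h (\<Sum>k\<in>?K x. \<tau> k))"
    by (intro H.indep_vars_lebesgue_integral ind) auto
  also have "\<dots> = (\<Prod>x\<in>set Y. (1 / sqrt g) ^ card (?K x) * tilted_moment (card (?K x) - 1) (alpha g \<rho>))"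
  proof (intro prod.cong refl)
    fix x assume "x \<in> set Y"
    then have ne: "?K x \<noteq> {}" by (auto simp: in_set_conv_nth)
    \<comment> \<open>The index of \<open>erlang_density\<close> is one less than the number of
      summands, hence the subtraction.\<close>
    have "distributed holding_space lborel (\<lambda>\<tau>. \<Sum>k\<in>?K x. \<tau> k) (erlang_density (card (?K x) - 1) 1)"
      using ne by (intro H.exponential_distributed_sum distributed_holding_time
          H.indep_vars_subset[OF indep_vars_holding_times]) auto
    then have "(LINT \<tau>|holding_space. ?h (\<Sum>k\<in>?K x. \<tau> k))
        = (LINT l|lborel. erlang_density (card (?K x) - 1) 1 l * ?h l)"
      by (intro distributed_integral[symmetric]) auto
    also have "\<dots> = (1 / sqrt g) ^ Suc (card (?K x) - 1) * tilted_moment (card (?K x) - 1) (alpha g \<rho>)"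
      by (rule erlang_gaussian_integral[OF assms])
    also have "Suc (card (?K x) - 1) = card (?K x)"
      using ne by (simp add: card_gt_0_iff)
    finally show "(LINT \<tau>|holding_space. ?h (\<Sum>k\<in>?K x. \<tau> k))
        = (1 / sqrt g) ^ card (?K x) * tilted_moment (card (?K x) - 1) (alpha g \<rho>)" .
  qed
  finally show ?thesis .
qed

text \<open>Both premises of \<open>eq\<close> hold almost surely under the conditioned measure, so
  \<open>f\<close> may be replaced by \<open>G\<close> there and the integral pushed forward to the
  holding times.\<close>

lemma cond_expect_walk_eq_holding_time_expectation:
  fixes Y :: "(int ^ 'd::finite) list" and f :: "'d sample \<Rightarrow> real"
  assumes Y: "Y \<in> walks n"
    and f: "f \<in> borel_measurable ctrw_space" and G: "G \<in> borel_measurable holding_space"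
    and eq: "\<And>\<omega>. (\<And>i. 0 \<le> fst \<omega> i) \<Longrightarrow> (\<And>i. i \<le> n \<Longrightarrow> jump_chain i \<omega> = Y ! i) \<Longrightarrow> f \<omega> = G (fst \<omega>)"
  shows "cond_expect_walk n Y f = (LINT \<tau>|holding_space. G \<tau>)"
proof -
  let ?A = "{\<omega> \<in> space ctrw_space. \<forall>i\<le>n. jump_chain i \<omega> = Y ! i}"
  let ?U = "uniform_measure ctrw_space ?A"
  have A: "?A \<in> sets ctrw_space" by measurable
  have d: "distr ?U holding_space fst = holding_space"
    by (rule distr_holding_times_given_walk[OF Y])
  have fst: "fst \<in> measurable ?U holding_space"
    by (simp cong: measurable_cong_sets)
  have "AE \<tau> in distr ?U holding_space fst. \<forall>i. 0 \<le> \<tau> i"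
    unfolding d by (rule AE_holding_time_nonneg)
  then have "AE \<omega> in ?U. \<forall>i. 0 \<le> fst \<omega> i"
    by (rule AE_distrD[OF fst])
  moreover have "AE \<omega> in ?U. \<omega> \<in> ?A"
    by (rule AE_uniform_measureI[OF A]) simp
  ultimately have "AE \<omega> in ?U. f \<omega> = G (fst \<omega>)"
    by eventually_elim (auto intro: eq)
  then have "cond_expect_walk n Y f = (LINT \<omega>|?U. G (fst \<omega>))"
    unfolding cond_expect_walk_def
    using f measurable_compose[OF fst G]
    by (intro integral_cong_AE) (auto cong: measurable_cong_sets)
  also have "\<dots> = (LINT \<tau>|distr ?U holding_space fst. G \<tau>)"
    using fst G by (simp add: integral_distr)
  finally show ?thesis unfolding d .
qed

subsection \<open>The weights of walks and their limits\<close>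

lemma limit_weight_eq: "limit_weight a Y = (\<Prod>x\<in>set Y. tilted_moment (visits Y x - 1) a)"
  unfolding limit_weight_def
proof (intro prod.cong refl)
  fix x assume "x \<in> set Y"
  then have "Suc (visits Y x - 1) = visits Y x" by (simp add: visits_pos)
  then show "exp (a\<^sup>2) * I_fun (visits Y x) a = tilted_moment (visits Y x - 1) a"
    using tilted_moment_eq[of a "visits Y x - 1"] by simp
qed

text \<open>A common prefactor is shared out among the sites according to their visits, so that each
  factor can be treated on its own.\<close>

lemma power_mult_limit_weight:
  "c ^ length Y * limit_weight a Y = (\<Prod>x\<in>set Y. c ^ visits Y x * tilted_moment (visits Y x - 1) a)"
  by (simp add: limit_weight_eq prod.distrib power_sum[symmetric] sum_visits)

lemma limit_weight_pos: "limit_weight a Y > 0"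
  unfolding limit_weight_eq by (intro prod_pos tilted_moment_pos ballI)

lemma weight_eq:
  fixes Y :: "(int ^ 'd::finite) list"
  assumes "g > 0" and Y: "Y \<in> walks n"
  shows "weight g \<rho> n Y = (1 / sqrt g) ^ Suc n * limit_weight (alpha g \<rho>) Y"
proof -
  have len: "length Y = Suc n" using Y by (simp add: walks_def)
  let ?K = "\<lambda>x. {k. k < length Y \<and> Y ! k = x}"
  have occ: "(\<Sum>k\<le>n. of_bool (Y ! k = x) * \<tau> k) = (\<Sum>k\<in>?K x. \<tau> k)" for x and \<tau> :: "nat \<Rightarrow> real"
    by (intro sum.mono_neutral_cong_right) (auto simp: len)
  have "weight g \<rho> n Y = (LINT \<tau>|holding_space. (\<Prod>x\<in>set Y.
      exp (- g * (\<Sum>k\<in>?K x. \<tau> k)\<^sup>2 + \<rho> * (\<Sum>k\<in>?K x. \<tau> k))))"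
    unfolding weight_def
  proof (rule cond_expect_walk_eq_holding_time_expectation[OF Y])
    \<comment> \<open>The infinite sums are replaced by finite ones for all \<open>\<omega>\<close>,
      as almost sure equality would not give measurability.\<close>
    have "(\<lambda>\<omega>. exp (- g * (\<Sum>\<^sub>\<infinity>x\<in>UNIV. (local_time x n \<omega>)\<^sup>2) + \<rho> * (\<Sum>\<^sub>\<infinity>x\<in>UNIV. local_time x n \<omega>)))
      = (\<lambda>\<omega>::'d sample. exp (- g * (\<Sum>k\<le>n. \<Sum>l\<le>n. of_bool (jump_chain k \<omega> = jump_chain l \<omega>)
          * (sojourn n (fst \<omega>) k * sojourn n (fst \<omega>) l)) + \<rho> * (\<Sum>k\<le>n. sojourn n (fst \<omega>) k)))"
      unfolding local_time_eq infsum_weighted_occupation ..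
    moreover have [measurable]: "(\<lambda>\<omega>::'d sample. fst \<omega> i) \<in> borel_measurable ctrw_space" for i
      by (rule measurable_compose[OF measurable_fst_ctrw_space borel_measurable_holding_time])
    ultimately show "(\<lambda>\<omega>::'d sample. exp (- g * (\<Sum>\<^sub>\<infinity>x\<in>UNIV. (local_time x n \<omega>)\<^sup>2)
        + \<rho> * (\<Sum>\<^sub>\<infinity>x\<in>UNIV. local_time x n \<omega>))) \<in> borel_measurable ctrw_space"
      by (simp only:) measurable
    show "(\<lambda>\<tau>. \<Prod>x\<in>set Y. exp (- g * (\<Sum>k\<in>?K x. \<tau> k)\<^sup>2 + \<rho> * (\<Sum>k\<in>?K x. \<tau> k)))
        \<in> borel_measurable holding_space"
      by measurable
    fix \<omega> :: "'d sample"
    assume nn: "\<And>i. 0 \<le> fst \<omega> i" and jc: "\<And>i. i \<le> n \<Longrightarrow> jump_chain i \<omega> = Y ! i"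
    have lt: "local_time x n \<omega> = (\<Sum>k\<in>?K x. fst \<omega> k)" for x
      unfolding local_time_eq occ[symmetric]
      using nn jc by (intro sum.cong refl) (simp add: sojourn_eq_holding_time)
    have K: "?K x = {}" if "x \<notin> set Y" for x using that by auto
    have "(\<Sum>\<^sub>\<infinity>x\<in>UNIV. local_time x n \<omega>) = (\<Sum>\<^sub>\<infinity>x\<in>set Y. local_time x n \<omega>)"
      "(\<Sum>\<^sub>\<infinity>x\<in>UNIV. (local_time x n \<omega>)\<^sup>2) = (\<Sum>\<^sub>\<infinity>x\<in>set Y. (local_time x n \<omega>)\<^sup>2)"
      unfolding lt by (rule infsum_cong_neutral; auto simp: K)+
    then show "exp (- g * (\<Sum>\<^sub>\<infinity>x\<in>UNIV. (local_time x n \<omega>)\<^sup>2) + \<rho> * (\<Sum>\<^sub>\<infinity>x\<in>UNIV. local_time x n \<omega>))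
        = (\<Prod>x\<in>set Y. exp (- g * (\<Sum>k\<in>?K x. fst \<omega> k)\<^sup>2 + \<rho> * (\<Sum>k\<in>?K x. fst \<omega> k)))"
      by (simp add: lt exp_sum[symmetric] sum.distrib sum_distrib_left sum_subtractf sum_negf)
  qed
  also have "\<dots> = (1 / sqrt g) ^ Suc n * limit_weight (alpha g \<rho>) Y"
    unfolding expectation_occupation_product[OF \<open>g > 0\<close>] visits_eq_card[symmetric]
      power_mult_limit_weight[symmetric] by (simp only: len)
  finally show ?thesis .
qed

text \<open>Any common factor \<open>c g\<close> may be inserted in numerator and denominator of \<open>Q_walk\<close>; choosing
  it well makes the limits of all the individual weights finite.\<close>
lemma Q_walk_tendsto:
  fixes L :: "(int ^ 'd::finite) list \<Rightarrow> real"
  assumes c: "eventually (\<lambda>g. c g \<noteq> 0) at_top"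
    and L: "\<And>Y. Y \<in> walks n \<Longrightarrow> ((\<lambda>g. c g ^ Suc n * limit_weight (alpha g (\<rho> g)) Y) \<longlongrightarrow> L Y) at_top"
    and "(\<Sum>Y\<in>walks n. L Y) \<noteq> 0" and Y: "Y \<in> walks n"
  shows "((\<lambda>g. Q_walk g (\<rho> g) n Y) \<longlongrightarrow> L Y / (\<Sum>Y'\<in>walks n. L Y')) at_top"
proof (rule Lim_transform_eventually)
  let ?W = "\<lambda>g (Y :: (int ^ 'd) list). c g ^ Suc n * limit_weight (alpha g (\<rho> g)) Y"
  show "((\<lambda>g. ?W g Y / (\<Sum>Y'\<in>walks n. ?W g Y')) \<longlongrightarrow> L Y / (\<Sum>Y'\<in>walks n. L Y')) at_top"
    by (intro tendsto_divide tendsto_sum L assms)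
  show "\<forall>\<^sub>F g in at_top. ?W g Y / (\<Sum>Y'\<in>walks n. ?W g Y') = Q_walk g (\<rho> g) n Y"
    using c eventually_gt_at_top[of 0]
  proof eventually_elim
    case (elim g)
    have "partition_function TYPE('d) g (\<rho> g) n
        = (1 / sqrt g) ^ Suc n * (\<Sum>Y'\<in>walks n. limit_weight (alpha g (\<rho> g)) (Y' :: (int ^ 'd) list))"
      unfolding partition_function_def sum_distrib_left
      by (intro sum.cong refl weight_eq elim)
    moreover have "(\<Sum>Y'\<in>walks n. ?W g Y') = c g ^ Suc n * (\<Sum>Y'\<in>walks n. limit_weight (alpha g (\<rho> g)) (Y' :: (int ^ 'd) list))"
      by (rule sum_distrib_left[symmetric])
    moreover have "c g ^ Suc n \<noteq> 0" "(1 / sqrt g) ^ Suc n \<noteq> 0" using elim by simp_all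
    ultimately show ?case
      unfolding Q_walk_def weight_eq[OF \<open>0 < g\<close> Y] by (simp del: power_Suc)
  qed
qed

lemma limit_norm_pos: "limit_norm TYPE('d::finite) n a > 0"
proof -
  have "(walks n :: (int ^ 'd) list set) \<noteq> {}"
    using saws_nonempty saws_subset_walks by blast
  then show ?thesis
    unfolding limit_norm_def by (intro sum_pos limit_weight_pos) auto
qed

theorem proposition2:
  fixes \<rho> :: "real \<Rightarrow> real" and a :: ereal and n :: nat and Y :: "(int ^ 'd::finite) list"
  assumes "((\<lambda>g. ereal (alpha g (\<rho> g))) \<longlongrightarrow> a) at_top"
    and "n \<ge> 1"
    and "Y \<in> walks n"
  shows "((\<lambda>g. Q_walk g (\<rho> g) n Y) \<longlongrightarrow>
           (case a of
              ereal r \<Rightarrow> 1 / limit_norm TYPE('d) n r * limit_weight r Y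
            | PInfty \<Rightarrow> 1 / real (card (saws n :: (int ^ 'd) list set)) * of_bool (Y \<in> saws n)
            | MInfty \<Rightarrow> 1 / (2 * real CARD('d)) ^ n)) at_top
    \<and> (\<forall>r. a = ereal r \<longrightarrow>
          (\<forall>Y'\<in>(walks n :: (int ^ 'd) list set). 0 \<le> 1 / limit_norm TYPE('d) n r * limit_weight r Y') \<and>
          (\<Sum>Y'\<in>(walks n :: (int ^ 'd) list set). 1 / limit_norm TYPE('d) n r * limit_weight r Y') = 1)"
proof
  let ?\<alpha> = "\<lambda>g. alpha g (\<rho> g)"
  \<comment> \<open>Every visited site has a positive count, so the exponent takes the form
    \<open>Suc k\<close> used in the asymptotics of \<open>tilted_moment\<close>.\<close>
  have scaled: "c ^ Suc n * limit_weight b Y'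
      = (\<Prod>x\<in>set Y'. c ^ Suc (visits Y' x - 1) * tilted_moment (visits Y' x - 1) b)"
    if "Y' \<in> walks n" for c b and Y' :: "(int ^ 'd) list"
  proof -
    have "length Y' = Suc n" using that by (simp add: walks_def)
    then show ?thesis
      using power_mult_limit_weight[of c Y' b] visits_pos[of _ Y'] by simp
  qed
  show "((\<lambda>g. Q_walk g (\<rho> g) n Y) \<longlongrightarrow>
           (case a of
              ereal r \<Rightarrow> 1 / limit_norm TYPE('d) n r * limit_weight r Y
            | PInfty \<Rightarrow> 1 / real (card (saws n :: (int ^ 'd) list set)) * of_bool (Y \<in> saws n)
            | MInfty \<Rightarrow> 1 / (2 * real CARD('d)) ^ n)) at_top"
  proof (cases a)
    case (real r)
    then have \<alpha>: "(?\<alpha> \<longlongrightarrow> r) at_top" using assms(1) by simp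
    have "((\<lambda>g. Q_walk g (\<rho> g) n Y) \<longlongrightarrow>
        limit_weight r Y / (\<Sum>Y'\<in>(walks n :: (int ^ 'd) list set). limit_weight r Y')) at_top"
    proof (rule Q_walk_tendsto[where c = "\<lambda>_. 1"])
      show "((\<lambda>g. 1 ^ Suc n * limit_weight (?\<alpha> g) Y') \<longlongrightarrow> limit_weight r Y') at_top"
        for Y' :: "(int ^ 'd) list"
        unfolding limit_weight_eq power_one mult_1_left by (intro tendsto_prod tendsto_tilted_moment \<alpha>)
      show "(\<Sum>Y'\<in>(walks n :: (int ^ 'd) list set). limit_weight r Y') \<noteq> 0"
        using limit_norm_pos[where 'd='d, of n r] by (simp add: limit_norm_def)
    qed (use assms in auto)
    then show ?thesis by (simp add: real limit_norm_def)
  next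
    case PInf
    then have \<alpha>: "filterlim ?\<alpha> at_top at_top"
      using assms(1) by (simp add: tendsto_PInfty_eq_at_top)
    let ?L = "\<lambda>Y'. of_bool (Y' \<in> saws n) * sqrt pi ^ Suc n"
    have sum_L: "(\<Sum>Y'\<in>(walks n :: (int ^ 'd) list set). ?L Y')
        = real (card (saws n :: (int ^ 'd) list set)) * sqrt pi ^ Suc n"
    proof -
      have "(\<Sum>Y'\<in>(walks n :: (int ^ 'd) list set). ?L Y') = (\<Sum>Y'\<in>(saws n :: (int ^ 'd) list set). sqrt pi ^ Suc n)"
        by (intro sum.mono_neutral_cong_right) (use saws_subset_walks in auto)
      then show ?thesis by simp
    qed
    have c0: "card (saws n :: (int ^ 'd) list set) \<noteq> 0"
      by (simp add: card_eq_0_iff saws_nonempty)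
    have "((\<lambda>g. Q_walk g (\<rho> g) n Y) \<longlongrightarrow>
        ?L Y / (\<Sum>Y'\<in>(walks n :: (int ^ 'd) list set). ?L Y')) at_top"
    proof (rule Q_walk_tendsto[where c = "\<lambda>g. exp (- (?\<alpha> g)\<^sup>2)"])
      fix Y' :: "(int ^ 'd) list" assume Y': "Y' \<in> walks n"
      have "((\<lambda>g. exp (- (?\<alpha> g)\<^sup>2) ^ Suc n * limit_weight (?\<alpha> g) Y')
          \<longlongrightarrow> (\<Prod>x\<in>set Y'. if visits Y' x - 1 = 0 then sqrt pi else 0)) at_top"
        unfolding scaled[OF Y']
        by (intro tendsto_prod filterlim_compose[OF tilted_moment_at_top \<alpha>])
      also have "(\<Prod>x\<in>set Y'. if visits Y' x - 1 = 0 then sqrt pi else 0) = ?L Y'"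
      proof (cases "Y' \<in> saws n")
        case True
        then have v: "\<forall>x\<in>set Y'. visits Y' x = 1" using saws_iff_visits[OF Y'] by simp
        \<comment> \<open>There are as many distinct sites as times, so the product has
          \<open>Suc n\<close> factors \<open>sqrt pi\<close>.\<close>
        then have "card (set Y') = Suc n"
          using sum_visits[of Y'] Y' by (simp add: walks_def)
        with v True show ?thesis by simp
      next
        case False
        \<comment> \<open>A single revisited site makes the whole product vanish.\<close>
        then obtain x where "x \<in> set Y'" "visits Y' x \<noteq> 1" using saws_iff_visits[OF Y'] by auto
        then have "\<exists>x\<in>set Y'. (if visits Y' x - 1 = 0 then sqrt pi else 0) = 0"
          using visits_pos[of x Y'] by (intro bexI[of _ x]) auto
        then show ?thesis using False by (simp add: prod_zero)
      qed
      finally show "((\<lambda>g. exp (- (?\<alpha> g)\<^sup>2) ^ Suc n * limit_weight (?\<alpha> g) Y') \<longlongrightarrow> ?L Y') at_top" .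
    qed (use assms c0 sum_L in auto)
    then show ?thesis using c0 by (simp add: PInf sum_L del: power_Suc)
  next
    case MInf
    then have "filterlim ?\<alpha> at_bot at_top"
      using assms(1) by (simp add: tendsto_MInfty filterlim_at_bot_dense)
    then have \<alpha>: "filterlim (\<lambda>g. - ?\<alpha> g) at_top at_top"
      by (simp add: filterlim_uminus_at_top)
    have card: "(\<Sum>Y'\<in>(walks n :: (int ^ 'd) list set). 1) = (2 * real CARD('d)) ^ n"
      by (simp add: card_walks)
    have "((\<lambda>g. Q_walk g (\<rho> g) n Y) \<longlongrightarrow> 1 / (\<Sum>Y'\<in>(walks n :: (int ^ 'd) list set). 1)) at_top"
    proof (rule Q_walk_tendsto[where c = "\<lambda>g. 2 * (- ?\<alpha> g)" and L = "\<lambda>_. 1"])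
      \<comment> \<open>The scaling factor tends to infinity, so it is nonzero for all large
        \<open>g\<close> even if it vanishes for some small ones.\<close>
      show "\<forall>\<^sub>F g in at_top. 2 * (- ?\<alpha> g) \<noteq> 0"
        using filterlim_at_top_dense[THEN iffD1, OF \<alpha>, rule_format, of 0] by eventually_elim auto
      fix Y' :: "(int ^ 'd) list" assume Y': "Y' \<in> walks n"
      \<comment> \<open>The double negation matches the argument \<open>- t\<close> of
        \<open>tilted_moment_at_bot\<close> at \<open>t = - ?\<alpha> g\<close>.\<close>
      have "((\<lambda>g. (2 * (- ?\<alpha> g)) ^ Suc n * limit_weight (- (- ?\<alpha> g)) Y') \<longlongrightarrow> (\<Prod>x\<in>set Y'. 1)) at_top"
        unfolding scaled[OF Y']
        by (intro tendsto_prod filterlim_compose[OF tilted_moment_at_bot \<alpha>])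
      then show "((\<lambda>g. (2 * (- ?\<alpha> g)) ^ Suc n * limit_weight (?\<alpha> g) Y') \<longlongrightarrow> 1) at_top"
        by simp
    qed (use assms card in auto)
    then show ?thesis unfolding card by (simp add: MInf)
  qed
  show "\<forall>r. a = ereal r \<longrightarrow>
          (\<forall>Y'\<in>(walks n :: (int ^ 'd) list set). 0 \<le> 1 / limit_norm TYPE('d) n r * limit_weight r Y') \<and>
          (\<Sum>Y'\<in>(walks n :: (int ^ 'd) list set). 1 / limit_norm TYPE('d) n r * limit_weight r Y') = 1"
  proof (intro allI impI conjI ballI)
    fix r :: real and Y' :: "(int ^ 'd) list"
    show "0 \<le> 1 / limit_norm TYPE('d) n r * limit_weight r Y'"
      using limit_norm_pos[where 'd='d, of n r] limit_weight_pos[of r Y'] by simp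
    show "(\<Sum>Y'\<in>(walks n :: (int ^ 'd) list set). 1 / limit_norm TYPE('d) n r * limit_weight r Y') = 1"
      using limit_norm_pos[where 'd='d, of n r]
      by (simp add: limit_norm_def sum_divide_distrib[symmetric])
  qed
qed

end
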